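(* Let $G$ be a countable, discrete group, $(H,\tau)$ a metrizable compactification of $G$, and let $\mathcal{W}(H)$ denote the collection of all windows $W\subseteq H$ that are proper, irredundant and generic. Then the map $$\Lambda:\mathcal{W}(H)\to\{x\in\{0,1\}^G: x\text{ is almost automorphic on }H\}$$ defined by $$\Lambda(W)(g)=1\iff \tau(g)\in W,\qquad\text{for every } g\in G \text{ and } W\in\mathcal{W}(H),$$ is well defined and bijective. Moreover, if $W\in\mathcal{W}(H)$, $x=\Lambda(W)$ and $\beta:\overline{O_G(x)}\to H$ is the factor map satisfying $\beta^{-1}(\{1_H\})=\{x\}$, then $$W=\{\xi\in H:\text{ there exists }y\in\beta^{-1}(\{\xi\})\text{ such that }y(1_G)=1\},$$ and its boundary is $$\partial W=W\setminus\{\xi\in H:\ \forall y\in\beta^{-1}(\{\xi\}),\ y(1_G)=1\}.$$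
   Context: A metrizable compactification of $G$ is a pair $(H,\tau)$ where $H$ is a compact metrizable group and $\tau:G\to H$ is an injective homomorphism with $\tau(G)$ dense in $H$. $G$ acts on $H$ by $g\cdot h=\tau(g)h$. The set $\{0,1\}^G$ carries the product topology and the shift action $(gx)(h)=x(hg)$ for $g,h\in G$; $O_G(x)=\{gx:g\in G\}$ is the orbit of $x$ and $\overline{O_G(x)}$ its closure. A factor map is a continuous, surjective, $G$-equivariant map. The unit elements of $G$ and $H$ are $1_G$ and $1_H$. An element $x\in\{0,1\}^G$ is almost automorphic on $H$ if there exists a factor map $\beta:\overline{O_G(x)}\to H$ with $\beta^{-1}(\{1_H\})=\{x\}$. A window is a subset $W\subseteq H$. It is proper if $\overline{\mathrm{int}(W)}=W$, irredundant if $Wh=W$ (with $h\in H$) implies $h=1_H$, and generic if $\partial W\cap\tau(G)=\emptyset$. *)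

theory Defs
  imports "HOL-Analysis.Analysis"
begin

text \<open>
  Groups are types of class \<^class>\<open>group_add\<close>, which is not assumed commutative: the product
  \<open>g h\<close> is written \<open>g + h\<close>, and the unit element is \<open>0\<close>.  The order of the summands
  therefore matters everywhere below.
  Points of \<open>{0,1}^G\<close> are functions of type \<open>'g \<Rightarrow> bool\<close>, with \<open>True\<close> for \<open>1\<close>; the library's
  topology on this type is the product topology of the discrete space \<^typ>\<open>bool\<close>.
\<close>

definition metrizable_compactification ::
    "('g::group_add \<Rightarrow> 'h::topological_group_add) \<Rightarrow> bool" where
  "metrizable_compactification \<tau> \<longleftrightarrow>
     compact (UNIV :: 'h set) \<and> metrizable_space (euclidean :: 'h topology) \<and>
     inj \<tau> \<and> (\<forall>a b. \<tau> (a + b) = \<tau> a + \<tau> b) \<and> closure (range \<tau>) = UNIV"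

definition translation_action ::
    "('g \<Rightarrow> 'h::group_add) \<Rightarrow> 'g \<Rightarrow> 'h \<Rightarrow> 'h" where
  "translation_action \<tau> g h = \<tau> g + h"

definition shift_action :: "'g::group_add \<Rightarrow> ('g \<Rightarrow> bool) \<Rightarrow> 'g \<Rightarrow> bool" where
  "shift_action g x = (\<lambda>h. x (h + g))"

definition shift_orbit :: "('g::group_add \<Rightarrow> bool) \<Rightarrow> ('g \<Rightarrow> bool) set" where
  "shift_orbit x = {shift_action g x | g. True}"

text \<open>
  Only the values of \<open>f\<close> on \<open>X\<close> are relevant.  The actions are passed as functions
  of a group element and a point.
\<close>

definition factor_map ::
    "('g \<Rightarrow> 'x::topological_space \<Rightarrow> 'x) \<Rightarrow> 'x set \<Rightarrow>
     ('g \<Rightarrow> 'y::topological_space \<Rightarrow> 'y) \<Rightarrow> 'y set \<Rightarrow> ('x \<Rightarrow> 'y) \<Rightarrow> bool" where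
  "factor_map actX X actY Y f \<longleftrightarrow>
     continuous_on X f \<and> f ` X = Y \<and> (\<forall>g. \<forall>x\<in>X. f (actX g x) = actY g (f x))"

definition orbit_closure_factor ::
    "('g::group_add \<Rightarrow> 'h::topological_group_add) \<Rightarrow> ('g \<Rightarrow> bool) \<Rightarrow>
     (('g \<Rightarrow> bool) \<Rightarrow> 'h) \<Rightarrow> bool" where
  "orbit_closure_factor \<tau> x \<beta> \<longleftrightarrow>
     factor_map shift_action (closure (shift_orbit x)) (translation_action \<tau>) UNIV \<beta>"

text \<open>The preimage \<open>\<beta>\<^sup>-\<^sup>1({\<xi>})\<close>, where \<open>\<beta>\<close> has the orbit closure of \<open>x\<close> as its domain.\<close>

definition orbit_closure_fibre ::
    "('g::group_add \<Rightarrow> bool) \<Rightarrow> (('g \<Rightarrow> bool) \<Rightarrow> 'h) \<Rightarrow> 'h \<Rightarrow> ('g \<Rightarrow> bool) set" where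
  "orbit_closure_fibre x \<beta> \<xi> = {y \<in> closure (shift_orbit x). \<beta> y = \<xi>}"

definition almost_automorphic ::
    "('g::group_add \<Rightarrow> 'h::topological_group_add) \<Rightarrow> ('g \<Rightarrow> bool) \<Rightarrow> bool" where
  "almost_automorphic \<tau> x \<longleftrightarrow>
     (\<exists>\<beta>. orbit_closure_factor \<tau> x \<beta> \<and> orbit_closure_fibre x \<beta> 0 = {x})"

definition proper_window :: "'h::topological_space set \<Rightarrow> bool" where
  "proper_window W \<longleftrightarrow> closure (interior W) = W"

definition irredundant_window :: "'h::group_add set \<Rightarrow> bool" where
  "irredundant_window W \<longleftrightarrow> (\<forall>h. (\<lambda>w. w + h) ` W = W \<longrightarrow> h = 0)"

definition generic_window :: "('g \<Rightarrow> 'h::topological_space) \<Rightarrow> 'h set \<Rightarrow> bool" where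
  "generic_window \<tau> W \<longleftrightarrow> frontier W \<inter> range \<tau> = {}"

definition windows :: "('g \<Rightarrow> 'h::topological_group_add) \<Rightarrow> 'h set set" where
  "windows \<tau> = {W. proper_window W \<and> irredundant_window W \<and> generic_window \<tau> W}"

definition window_point :: "('g \<Rightarrow> 'h) \<Rightarrow> 'h set \<Rightarrow> 'g \<Rightarrow> bool" where
  "window_point \<tau> W = (\<lambda>g. \<tau> g \<in> W)"

end

theory Submission
  imports Defs
begin

text \<open>
  Everything rests on one relation between points \<open>y\<close> of the shift and points \<open>\<xi>\<close> of \<open>H\<close>:
  \<open>y\<close> is compatible with \<open>\<xi>\<close> when \<open>y\<close> reads off, along \<open>G\<close>, the visits of \<open>\<tau>(g) \<xi>\<close> to the
  window \<open>W\<close>, with either answer permitted while \<open>\<tau>(g) \<xi>\<close> lies on the boundary.  For closed \<open>W\<close>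
  this is a closed relation that contains the pairs \<open>(g x, \<tau>(g))\<close> with \<open>x = \<Lambda>(W)\<close>, and four
  observations give the theorem.

  \<^item> If \<open>W\<close> is proper and irredundant, \<open>y\<close> determines \<open>\<xi>\<close>: two candidates \<open>\<xi>\<close>, \<open>\<xi>'\<close> force
    \<open>W \<xi>\<^sup>-\<^sup>1 = W \<xi>'\<^sup>-\<^sup>1\<close> by density (\<open>compatible_unique\<close>).  So the relation is the graph of a map
    on the orbit closure, and a closed graph over a compact target makes that map continuous.
    If \<open>W\<close> is also generic, only \<open>x\<close> is compatible with \<open>1\<^sub>H\<close>.  Hence \<open>x\<close> is almost automorphic
    (\<open>window_point_almost_automorphic\<close>).

  \<^item> Conversely, every factor map \<open>\<beta>\<close> with \<open>\<beta>(x) = 1\<^sub>H\<close> has its graph inside the relation, since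
    this is so on the dense orbit (\<open>factor_compatible\<close>).  The two formulas for \<open>W\<close> and its boundary
    follow because the sets \<open>\<beta>({y. y(1\<^sub>G) = 1})\<close> and \<open>\<beta>({y. y(1\<^sub>G) = 0})\<close> are images of compact
    sets, hence closed.

  \<^item> A proper window is the closure of its trace on the dense subgroup \<open>\<tau>(G)\<close>, so \<open>\<Lambda>\<close> is injective.

  \<^item> For an almost automorphic \<open>x\<close>, the set \<open>\<beta>({y. y(1\<^sub>G) = 1})\<close> is a window that \<open>\<Lambda>\<close> maps to \<open>x\<close>
    (\<open>almost_automorphic_window\<close>); the decisive point is that the fibre over \<open>\<tau>(g)\<close> is the single
    point \<open>g x\<close>, being the translate of the fibre over \<open>1\<^sub>H\<close>.
\<close>

section \<open>Topological preliminaries\<close>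

lemma metrizable_compactification_simps:
  assumes "metrizable_compactification \<tau>"
  shows "\<tau> (a + b) = \<tau> a + \<tau> b" "\<tau> 0 = 0" "closure (range \<tau>) = UNIV"
proof -
  show hom: "\<tau> (a + b) = \<tau> a + \<tau> b" for a b
    using assms by (simp add: metrizable_compactification_def)
  show "\<tau> 0 = 0"
    using hom[of 0 0] by (metis add_0_right add_left_cancel)
  show "closure (range \<tau>) = UNIV"
    using assms by (simp add: metrizable_compactification_def)
qed

lemma compact_if_closed_bool_fun:
  fixes S :: "('g \<Rightarrow> bool) set"
  assumes "closed S"
  shows "compact S"
proof -
  have "compact (UNIV :: bool set)"
    by (simp add: finite_imp_compact)
  then have "compact_space (euclidean :: bool topology)"
    by (simp add: compact_space_def)
  then have "compact_space (product_topology (\<lambda>_::'g. euclidean :: bool topology) UNIV)"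
    by (simp add: compact_space_product_topology)
  then have "compact (UNIV :: ('g \<Rightarrow> bool) set)"
    by (simp add: euclidean_product_topology compact_space_def)
  then show ?thesis
    using assms compact_Int_closed[of UNIV S] by simp
qed

text \<open>
  The type of \<open>H\<close> carries no separation axiom; metrizability of \<open>H\<close> supplies the Hausdorff
  property that closes compact images.
\<close>
lemma closed_factor_image:
  fixes \<beta> :: "('g \<Rightarrow> bool) \<Rightarrow> 'h::topological_space"
  assumes "metrizable_space (euclidean :: 'h topology)"
    and "continuous_on X \<beta>" "closed S" "S \<subseteq> X"
  shows "closed (\<beta> ` S)"
proof -
  have "compact (\<beta> ` S)"
    using assms compact_if_closed_bool_fun continuous_on_subset compact_continuous_image by blast
  then have "closedin euclidean (\<beta> ` S)"
    using assms(1) by (intro compactin_imp_closedin metrizable_imp_Hausdorff_space) auto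
  then show ?thesis
    by simp
qed

lemma closed_fst_image:
  fixes R :: "('x::topological_space \<times> 'h::topological_space) set"
  assumes "compact (UNIV :: 'h set)" "closed R"
  shows "closed (fst ` R)"
proof -
  have "closed_map (prod_topology euclidean (euclidean :: 'h topology))
          (euclidean :: 'x topology) fst"
    using assms(1) by (intro Abstract_Topological_Spaces.closed_map_fst) (simp add: compact_space_def)
  then show ?thesis
    using assms(2) by (simp add: closed_map_def)
qed

lemma continuous_on_coordinate:
  "continuous_on A (\<lambda>y :: 'g \<Rightarrow> bool. y g)"
  by (rule continuous_on_product_coordinates[THEN continuous_on_subset]) simp

lemma
  shows closed_coordinate: "closed {y :: 'g \<Rightarrow> bool. y g = b}"
    and open_coordinate: "open {y :: 'g \<Rightarrow> bool. y g = b}"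
proof -
  have "closed {b}"
    by (rule closed_singleton)
  then show "closed {y :: 'g \<Rightarrow> bool. y g = b}"
    using closed_vimage[OF _ continuous_on_coordinate, of "{b}" g] by (simp add: vimage_def)
  have "open {b}"
    by (rule open_discrete)
  then show "open {y :: 'g \<Rightarrow> bool. y g = b}"
    using open_vimage[OF _ continuous_on_coordinate, of "{b}" g] by (simp add: vimage_def)
qed

lemma continuous_on_right_translation:
  "continuous_on A (\<lambda>h. h + a :: 'h::topological_group_add)"
  by (intro continuous_intros)

lemma dense_right_translate:
  fixes \<tau> :: "'g \<Rightarrow> 'h::topological_group_add"
  assumes "closure (range \<tau>) = UNIV"
  shows "closure (range (\<lambda>g. \<tau> g + \<xi>)) = UNIV"
proof -
  have "(\<lambda>h. h + \<xi>) ` closure (range \<tau>) \<subseteq> closure (range (\<lambda>g. \<tau> g + \<xi>))"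
    by (rule image_closure_subset[OF continuous_on_right_translation])
      (auto intro: closure_subset[THEN subsetD])
  moreover have "h \<in> (\<lambda>h. h + \<xi>) ` UNIV" for h
    by (rule image_eqI[of _ _ "h - \<xi>"]) auto
  ultimately show ?thesis
    using assms by auto
qed

lemma proper_window_closed: "proper_window W \<Longrightarrow> closed W"
  by (metis closed_closure proper_window_def)

lemma proper_window_dense_trace:
  assumes "proper_window W" "closure D = UNIV"
  shows "W = closure (interior W \<inter> D)"
proof
  have "interior W \<subseteq> closure (interior W \<inter> D)"
    using open_Int_closure_subset[of "interior W" D] assms(2) by simp
  then show "W \<subseteq> closure (interior W \<inter> D)"
    using assms(1) closure_minimal[OF _ closed_closure] by (metis proper_window_def)
  show "closure (interior W \<inter> D) \<subseteq> W"
    using closure_mono[of "interior W \<inter> D" "interior W"] assms(1)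
    by (simp add: proper_window_def)
qed

lemma generic_window_trace:
  assumes "closed W" "generic_window \<tau> W"
  shows "\<tau> g \<in> interior W \<longleftrightarrow> \<tau> g \<in> W"
  using assms interior_subset[of W] by (auto simp: generic_window_def frontier_def closure_closed)

section \<open>Orbit closures and factor maps\<close>

lemma shift_action_shift_action:
  "shift_action a (shift_action b y) = shift_action (a + b) y"
  by (simp add: shift_action_def add.assoc)

lemma shift_action_0 [simp]: "shift_action 0 y = y"
  by (simp add: shift_action_def)

lemma shift_in_orbit_closure: "shift_action g x \<in> closure (shift_orbit x)"
  by (rule closure_subset[THEN subsetD]) (auto simp: shift_orbit_def)

lemma self_in_orbit_closure: "x \<in> closure (shift_orbit x)"
  using shift_in_orbit_closure[of 0 x] by simp

lemma orbit_closure_invariant: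
  assumes "y \<in> closure (shift_orbit x)"
  shows "shift_action g y \<in> closure (shift_orbit x)"
proof -
  have "continuous_on (closure (shift_orbit x)) (shift_action g)"
    unfolding shift_action_def
    by (intro continuous_on_coordinatewise_then_product continuous_on_coordinate)
  moreover have "shift_action g ` shift_orbit x \<subseteq> closure (shift_orbit x)"
    using shift_in_orbit_closure by (auto simp: shift_orbit_def shift_action_shift_action)
  ultimately show ?thesis
    using assms image_closure_subset by blast
qed

lemma orbit_closure_factorD:
  assumes "orbit_closure_factor \<tau> x \<beta>"
  shows "continuous_on (closure (shift_orbit x)) \<beta>"
    and "\<beta> ` closure (shift_orbit x) = UNIV"
    and "y \<in> closure (shift_orbit x) \<Longrightarrow> \<beta> (shift_action g y) = \<tau> g + \<beta> y"
  using assms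
  by (auto simp: orbit_closure_factor_def factor_map_def translation_action_def)

lemma factor_on_orbit:
  assumes "orbit_closure_factor \<tau> x \<beta>" "\<beta> x = 0"
  shows "\<beta> (shift_action g x) = \<tau> g"
  using orbit_closure_factorD(3)[OF assms(1) self_in_orbit_closure] assms(2) by simp

text \<open>Translating by \<open>-g\<close> carries the fibre over \<open>\<tau> g\<close> into the fibre over \<open>0\<close>.\<close>
lemma fibre_over_orbit:
  assumes "metrizable_compactification \<tau>" "orbit_closure_factor \<tau> x \<beta>"
    and "orbit_closure_fibre x \<beta> 0 = {x}"
  shows "orbit_closure_fibre x \<beta> (\<tau> g) = {shift_action g x}"
proof -
  note hom = metrizable_compactification_simps[OF assms(1)]
  have x0: "\<beta> x = 0"
    using assms(3) by (auto simp: orbit_closure_fibre_def)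
  have "y = shift_action g x" if y: "y \<in> closure (shift_orbit x)" "\<beta> y = \<tau> g" for y
  proof -
    have "\<beta> (shift_action (- g) y) = 0"
      using orbit_closure_factorD(3)[OF assms(2) y(1)] y(2) hom(1)[of "- g" g] hom(2) by simp
    then have "shift_action (- g) y = x"
      using orbit_closure_invariant[OF y(1)] assms(3) by (auto simp: orbit_closure_fibre_def)
    then have "shift_action g x = shift_action g (shift_action (- g) y)"
      by simp
    then show ?thesis
      by (simp add: shift_action_shift_action)
  qed
  then show ?thesis
    using shift_in_orbit_closure factor_on_orbit[OF assms(2) x0]
    by (auto simp: orbit_closure_fibre_def)
qed

section \<open>Compatibility of symbolic points with points of the compactification\<close>

definition window_compatible ::
    "('g \<Rightarrow> 'h::topological_group_add) \<Rightarrow> 'h set \<Rightarrow> ('g \<Rightarrow> bool) \<Rightarrow> 'h \<Rightarrow> bool" where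
  "window_compatible \<tau> W y \<xi> \<longleftrightarrow>
     (\<forall>g. (\<tau> g + \<xi> \<in> interior W \<longrightarrow> y g) \<and> (y g \<longrightarrow> \<tau> g + \<xi> \<in> W))"

lemma closed_window_compatible:
  fixes \<tau> :: "'g \<Rightarrow> 'h::topological_group_add"
  assumes "closed W"
  shows "closed {p. window_compatible \<tau> W (fst p) (snd p)}"
proof -
  have coord: "closed {p :: ('g \<Rightarrow> bool) \<times> 'h. fst p g = b}" for g b
    using closed_vimage[OF closed_coordinate[of g b] continuous_on_fst[OF continuous_on_id]]
    by (simp add: vimage_def)
  have vim: "closed {p :: ('g \<Rightarrow> bool) \<times> 'h. \<tau> g + snd p \<in> C}" if "closed C" for g C
  proof -
    have "continuous_on UNIV (\<lambda>p :: ('g \<Rightarrow> bool) \<times> 'h. \<tau> g + snd p)"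
      by (intro continuous_intros)
    from closed_vimage[OF that this]
    show "closed {p :: ('g \<Rightarrow> bool) \<times> 'h. \<tau> g + snd p \<in> C}"
      by (simp add: vimage_def)
  qed
  have "closed (\<Inter>g. ({p :: ('g \<Rightarrow> bool) \<times> 'h. \<tau> g + snd p \<in> - interior W} \<union> {p. fst p g = True})
                 \<inter> ({p. fst p g = False} \<union> {p. \<tau> g + snd p \<in> W}))"
    using vim[of "- interior W"] vim[of W] assms
    by (intro closed_INT ballI closed_Int closed_Un coord) auto
  also have "(\<Inter>g. ({p :: ('g \<Rightarrow> bool) \<times> 'h. \<tau> g + snd p \<in> - interior W} \<union> {p. fst p g = True})
                 \<inter> ({p. fst p g = False} \<union> {p. \<tau> g + snd p \<in> W}))
      = {p. window_compatible \<tau> W (fst p) (snd p)}"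
    by (auto simp: window_compatible_def)
  finally show ?thesis .
qed

lemma orbit_window_compatible:
  assumes "\<And>a b. \<tau> (a + b) = \<tau> a + \<tau> b"
  shows "window_compatible \<tau> W (shift_action g (window_point \<tau> W)) (\<tau> g)"
  using interior_subset[of W]
  by (auto simp: window_compatible_def shift_action_def window_point_def assms)

lemma shift_window_compatible:
  assumes "\<And>a b. \<tau> (a + b) = \<tau> a + \<tau> b" "window_compatible \<tau> W y \<xi>"
  shows "window_compatible \<tau> W (shift_action g y) (\<tau> g + \<xi>)"
proof -
  have "\<tau> h + (\<tau> g + \<xi>) = \<tau> (h + g) + \<xi>" for h
    by (simp add: assms(1) add.assoc)
  then show ?thesis
    using assms(2) by (simp add: window_compatible_def shift_action_def)
qed

text \<open>
  The points \<open>\<tau> g + \<xi>\<close> inside the interior of \<open>W\<close> are dense in \<open>W\<close>, and the right translation by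
  \<open>- \<xi> + \<xi>'\<close> takes each of them to \<open>\<tau> g + \<xi>'\<close>, which lies in \<open>W\<close> because \<open>y g\<close> holds.
\<close>
lemma compatible_translate:
  assumes "closure (range \<tau>) = UNIV" "proper_window W"
    and "window_compatible \<tau> W y \<xi>" "window_compatible \<tau> W y \<xi>'" "w \<in> W"
  shows "w + (- \<xi> + \<xi>') \<in> W"
proof -
  have "(\<lambda>w. w + (- \<xi> + \<xi>')) ` closure (interior W \<inter> range (\<lambda>g. \<tau> g + \<xi>)) \<subseteq> W"
  proof (rule image_closure_subset[OF continuous_on_right_translation])
    show "closed W"
      using assms(2) by (rule proper_window_closed)
    have "\<tau> g + \<xi> + (- \<xi> + \<xi>') \<in> W" if "\<tau> g + \<xi> \<in> interior W" for g
    proof -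
      have "\<tau> g + \<xi> + (- \<xi> + \<xi>') = \<tau> g + \<xi>'"
        by (simp add: add.assoc)
      then show ?thesis
        using that assms(3,4) unfolding window_compatible_def by metis
    qed
    then show "(\<lambda>w. w + (- \<xi> + \<xi>')) ` (interior W \<inter> range (\<lambda>g. \<tau> g + \<xi>)) \<subseteq> W"
      by auto
  qed
  then show ?thesis
    using proper_window_dense_trace[OF assms(2) dense_right_translate[OF assms(1)]] assms(5)
    by blast
qed

lemma compatible_unique:
  assumes "closure (range \<tau>) = UNIV" "proper_window W" "irredundant_window W"
    and "window_compatible \<tau> W y \<xi>" "window_compatible \<tau> W y \<xi>'"
  shows "\<xi> = \<xi>'"
proof -
  have "(\<lambda>w. w + (- \<xi> + \<xi>')) ` W = W"
  proof
    show "(\<lambda>w. w + (- \<xi> + \<xi>')) ` W \<subseteq> W"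
      using compatible_translate[OF assms(1,2,4,5)] by auto
    show "W \<subseteq> (\<lambda>w. w + (- \<xi> + \<xi>')) ` W"
    proof
      fix w assume "w \<in> W"
      then have "w + (- \<xi>' + \<xi>) \<in> W"
        using compatible_translate[OF assms(1,2,5,4)] by blast
      then show "w \<in> (\<lambda>w. w + (- \<xi> + \<xi>')) ` W"
        by (rule rev_image_eqI) (simp add: add.assoc)
    qed
  qed
  then have "- \<xi> + \<xi>' = 0"
    using assms(3) by (auto simp: irredundant_window_def)
  then show ?thesis
    by (metis add.right_neutral add_minus_cancel)
qed

text \<open>The compatible points of the orbit closure form a closed set that contains the orbit.\<close>
lemma factor_compatible:
  assumes "\<And>a b. \<tau> (a + b) = \<tau> a + \<tau> b" "closed W" "x = window_point \<tau> W"
    and "orbit_closure_factor \<tau> x \<beta>" "\<beta> x = 0" "y \<in> closure (shift_orbit x)"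
  shows "window_compatible \<tau> W y (\<beta> y)"
proof -
  let ?X = "closure (shift_orbit x)"
  let ?C = "?X \<inter> (\<lambda>y. (y, \<beta> y)) -` {p. window_compatible \<tau> W (fst p) (snd p)}"
  have "closed ?C"
    by (intro continuous_closed_preimage closed_window_compatible assms(2) closed_closure
        continuous_intros orbit_closure_factorD(1)[OF assms(4)])
  moreover have "shift_orbit x \<subseteq> ?C"
    using shift_in_orbit_closure factor_on_orbit[OF assms(4,5)]
      orbit_window_compatible[OF assms(1), of W]
    by (auto simp: shift_orbit_def assms(3))
  ultimately have "?X \<subseteq> ?C"
    by (rule closure_minimal[rotated])
  then show ?thesis
    using assms(6) by auto
qed

section \<open>From windows to almost automorphic points\<close>

lemma window_point_almost_automorphic:
  fixes \<tau> :: "'g::group_add \<Rightarrow> 'h::topological_group_add"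
  assumes "metrizable_compactification \<tau>" "W \<in> windows \<tau>"
  shows "almost_automorphic \<tau> (window_point \<tau> W)"
proof -
  define x where "x = window_point \<tau> W"
  define X where "X = closure (shift_orbit x)"
  define R where "R = {p. window_compatible \<tau> W (fst p) (snd p)}"
  define \<beta> where "\<beta> y = (THE \<xi>. window_compatible \<tau> W y \<xi>)" for y
  note hom = metrizable_compactification_simps[OF assms(1)]
  have cpt: "compact (UNIV :: 'h set)" and metr: "metrizable_space (euclidean :: 'h topology)"
    using assms(1) by (auto simp: metrizable_compactification_def)
  have W: "proper_window W" "irredundant_window W" "generic_window \<tau> W"
    using assms(2) by (auto simp: windows_def)
  note W_closed = proper_window_closed[OF W(1)]
  have R_closed: "closed R"
    unfolding R_def by (rule closed_window_compatible[OF W_closed])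
  have \<beta>_eq: "\<beta> y = \<xi>" if "window_compatible \<tau> W y \<xi>" for y \<xi>
    unfolding \<beta>_def using that compatible_unique[OF hom(3) W(1,2)] by blast
  have "(shift_action g x, \<tau> g) \<in> R" for g
    using orbit_window_compatible[OF hom(1)] by (simp add: R_def x_def)
  then have "shift_action g x \<in> fst ` R" for g
    by (metis fst_conv image_eqI)
  then have "shift_orbit x \<subseteq> fst ` R"
    by (auto simp: shift_orbit_def)
  \<comment> \<open>Projection along the compact \<open>H\<close> preserves closedness, so no point of the closure is missed.\<close>
  then have "X \<subseteq> fst ` R"
    unfolding X_def by (rule closure_minimal) (rule closed_fst_image[OF cpt R_closed])
  then have \<beta>_compat: "window_compatible \<tau> W y (\<beta> y)" if "y \<in> X" for y
    using that \<beta>_eq by (force simp: R_def)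
  have cont: "continuous_on X \<beta>"
    unfolding continuous_on_closed_invariant
  proof (intro allI impI)
    \<comment> \<open>On \<open>X\<close> the graph of \<open>\<beta>\<close> is \<open>R\<close>, so the preimage of \<open>B\<close> is a projection of a closed set.\<close>
    fix B :: "'h set" assume "closed B"
    then have "closed (fst ` (R \<inter> UNIV \<times> B))"
      by (intro closed_fst_image cpt closed_Int R_closed closed_Times closed_UNIV)
    moreover have "fst ` (R \<inter> UNIV \<times> B) \<inter> X = \<beta> -` B \<inter> X"
    proof (intro equalityI subsetI)
      fix y assume "y \<in> fst ` (R \<inter> UNIV \<times> B) \<inter> X"
      then show "y \<in> \<beta> -` B \<inter> X"
        using \<beta>_eq by (auto simp: R_def)
    next
      fix y assume y: "y \<in> \<beta> -` B \<inter> X"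
      then have "(y, \<beta> y) \<in> R \<inter> UNIV \<times> B"
        using \<beta>_compat by (auto simp: R_def)
      then show "y \<in> fst ` (R \<inter> UNIV \<times> B) \<inter> X"
        using y by force
    qed
    ultimately show "\<exists>A. closed A \<and> A \<inter> X = \<beta> -` B \<inter> X"
      by blast
  qed
  have "\<tau> g \<in> \<beta> ` X" for g
  proof (rule image_eqI)
    show "\<tau> g = \<beta> (shift_action g x)"
      using \<beta>_eq[OF orbit_window_compatible[OF hom(1)]] by (simp add: x_def)
    show "shift_action g x \<in> X"
      by (simp add: X_def shift_in_orbit_closure)
  qed
  then have "range \<tau> \<subseteq> \<beta> ` X"
    by blast
  moreover have "closed (\<beta> ` X)"
    by (rule closed_factor_image[OF metr cont]) (auto simp: X_def)
  ultimately have surj: "\<beta> ` X = UNIV"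
    using closure_minimal[of "range \<tau>" "\<beta> ` X"] hom(3) by auto
  have equi: "\<beta> (shift_action g y) = \<tau> g + \<beta> y" if "y \<in> X" for g y
    using \<beta>_eq shift_window_compatible[OF hom(1)] \<beta>_compat[OF that] by blast
  have "orbit_closure_factor \<tau> x \<beta>"
    using cont surj equi
    by (simp add: orbit_closure_factor_def factor_map_def translation_action_def X_def)
  moreover have "orbit_closure_fibre x \<beta> 0 = {x}"
  proof -
    have "window_compatible \<tau> W x 0"
      using orbit_window_compatible[OF hom(1), of W 0] hom(2) by (simp add: x_def)
    then have "\<beta> x = 0"
      by (rule \<beta>_eq)
    moreover have "y = x" if "y \<in> X" "\<beta> y = 0" for y
    proof
      fix g
      show "y g = x g"
        using \<beta>_compat[OF that(1)] that(2) generic_window_trace[OF W_closed W(3), of g]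
        by (auto simp: window_compatible_def x_def window_point_def)
    qed
    ultimately show ?thesis
      using self_in_orbit_closure[of x] unfolding orbit_closure_fibre_def X_def by blast
  qed
  ultimately show ?thesis
    unfolding almost_automorphic_def x_def by blast
qed

lemma window_point_inj:
  assumes "closure (range \<tau>) = UNIV"
  shows "inj_on (window_point \<tau>) (windows \<tau>)"
proof -
  have "W = closure (\<tau> ` {g. window_point \<tau> W g})" if "W \<in> windows \<tau>" for W
  proof
    have W: "proper_window W"
      using that by (simp add: windows_def)
    have "interior W \<inter> range \<tau> \<subseteq> \<tau> ` {g. window_point \<tau> W g}"
      using interior_subset[of W] by (auto simp: window_point_def)
    then show "W \<subseteq> closure (\<tau> ` {g. window_point \<tau> W g})"
      using proper_window_dense_trace[OF W assms] closure_mono by blast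
    show "closure (\<tau> ` {g. window_point \<tau> W g}) \<subseteq> W"
      by (rule closure_minimal[OF _ proper_window_closed[OF W]]) (auto simp: window_point_def)
  qed
  then show ?thesis
    unfolding inj_on_def by metis
qed

section \<open>The window seen by a factor map\<close>

text \<open>
  Since \<open>W\<close> is proper, the points \<open>\<tau> g\<close> in \<open>W\<close> are dense in \<open>W\<close>, and they are images
  of points \<open>y\<close> with \<open>y 0\<close>; the set of all images of such points is closed.  The other inclusion is
  compatibility at the unit of \<open>G\<close>.
\<close>
lemma window_from_factor:
  fixes \<tau> :: "'g::group_add \<Rightarrow> 'h::topological_group_add"
  assumes "metrizable_compactification \<tau>" "proper_window W" "x = window_point \<tau> W"
    and "orbit_closure_factor \<tau> x \<beta>" "\<beta> x = 0"
  shows "W = {\<xi>. \<exists>y \<in> orbit_closure_fibre x \<beta> \<xi>. y 0}"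
proof
  note hom = metrizable_compactification_simps[OF assms(1)]
  have metr: "metrizable_space (euclidean :: 'h topology)"
    using assms(1) by (simp add: metrizable_compactification_def)
  let ?S = "closure (shift_orbit x) \<inter> {y. y 0 = True}"
  have eq: "{\<xi>. \<exists>y \<in> orbit_closure_fibre x \<beta> \<xi>. y 0} = \<beta> ` ?S"
    by (auto simp: orbit_closure_fibre_def)
  have "closed (\<beta> ` ?S)"
    by (rule closed_factor_image[OF metr orbit_closure_factorD(1)[OF assms(4)]])
      (intro closed_Int closed_closure closed_coordinate Int_lower1)+
  moreover have "interior W \<inter> range \<tau> \<subseteq> \<beta> ` ?S"
  proof
    fix \<xi> assume "\<xi> \<in> interior W \<inter> range \<tau>"
    then obtain g where g: "\<xi> = \<tau> g" "\<tau> g \<in> W"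
      using interior_subset by blast
    have "shift_action g x \<in> ?S"
      using shift_in_orbit_closure g(2)
      by (simp add: assms(3) shift_action_def window_point_def)
    then show "\<xi> \<in> \<beta> ` ?S"
      using factor_on_orbit[OF assms(4,5), of g] g(1) by force
  qed
  ultimately show "W \<subseteq> {\<xi>. \<exists>y \<in> orbit_closure_fibre x \<beta> \<xi>. y 0}"
    unfolding eq using proper_window_dense_trace[OF assms(2) hom(3)] closure_minimal by metis
  show "{\<xi>. \<exists>y \<in> orbit_closure_fibre x \<beta> \<xi>. y 0} \<subseteq> W"
  proof
    fix \<xi> assume "\<xi> \<in> {\<xi>. \<exists>y \<in> orbit_closure_fibre x \<beta> \<xi>. y 0}"
    then obtain y where y: "y \<in> closure (shift_orbit x)" "\<beta> y = \<xi>" "y 0"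
      by (auto simp: orbit_closure_fibre_def)
    have "window_compatible \<tau> W y \<xi>"
      using factor_compatible[OF hom(1) proper_window_closed[OF assms(2)] assms(3-5) y(1)] y(2)
      by simp
    then show "\<xi> \<in> W"
      using y(3) hom(2) by (force simp: window_compatible_def)
  qed
qed

lemma open_all_fibre:
  fixes \<tau> :: "'g::group_add \<Rightarrow> 'h::topological_group_add"
  assumes "metrizable_compactification \<tau>" "orbit_closure_factor \<tau> x \<beta>"
  shows "open {\<xi>. \<forall>y \<in> orbit_closure_fibre x \<beta> \<xi>. y 0}"
proof -
  have metr: "metrizable_space (euclidean :: 'h topology)"
    using assms(1) by (simp add: metrizable_compactification_def)
  have "closed (\<beta> ` (closure (shift_orbit x) \<inter> {y. y 0 = False}))"
    by (rule closed_factor_image[OF metr orbit_closure_factorD(1)[OF assms(2)]])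
      (intro closed_Int closed_closure closed_coordinate Int_lower1)+
  moreover have "{\<xi>. \<forall>y \<in> orbit_closure_fibre x \<beta> \<xi>. y 0}
      = - \<beta> ` (closure (shift_orbit x) \<inter> {y. y 0 = False})"
    by (auto simp: orbit_closure_fibre_def)
  ultimately show ?thesis
    by (simp add: open_Compl)
qed

text \<open>Fibres are nonempty because a factor map is surjective.\<close>
lemma all_fibre_subset_ex_fibre:
  assumes "orbit_closure_factor \<tau> x \<beta>"
  shows "{\<xi>. \<forall>y \<in> orbit_closure_fibre x \<beta> \<xi>. y 0} \<subseteq> {\<xi>. \<exists>y \<in> orbit_closure_fibre x \<beta> \<xi>. y 0}"
proof -
  have "orbit_closure_fibre x \<beta> \<xi> \<noteq> {}" for \<xi>
  proof -
    have "\<xi> \<in> \<beta> ` closure (shift_orbit x)"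
      by (simp add: orbit_closure_factorD(2)[OF assms])
    then show ?thesis
      by (auto simp: orbit_closure_fibre_def)
  qed
  then show ?thesis
    by blast
qed

lemma interior_window_from_factor:
  fixes \<tau> :: "'g::group_add \<Rightarrow> 'h::topological_group_add"
  assumes "metrizable_compactification \<tau>" "proper_window W" "x = window_point \<tau> W"
    and "orbit_closure_factor \<tau> x \<beta>" "\<beta> x = 0"
  shows "interior W = {\<xi>. \<forall>y \<in> orbit_closure_fibre x \<beta> \<xi>. y 0}"
proof
  note hom = metrizable_compactification_simps[OF assms(1)]
  show "{\<xi>. \<forall>y \<in> orbit_closure_fibre x \<beta> \<xi>. y 0} \<subseteq> interior W"
    using all_fibre_subset_ex_fibre[OF assms(4)] window_from_factor[OF assms]
      open_all_fibre[OF assms(1,4)] by (intro interior_maximal) auto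
  show "interior W \<subseteq> {\<xi>. \<forall>y \<in> orbit_closure_fibre x \<beta> \<xi>. y 0}"
  proof safe
    fix \<xi> y assume \<xi>: "\<xi> \<in> interior W" and "y \<in> orbit_closure_fibre x \<beta> \<xi>"
    then have "window_compatible \<tau> W y \<xi>"
      using factor_compatible[OF hom(1) proper_window_closed[OF assms(2)] assms(3-5)]
      by (auto simp: orbit_closure_fibre_def)
    then show "y 0"
      using \<xi> hom(2) by (force simp: window_compatible_def)
  qed
qed

section \<open>From almost automorphic points to windows\<close>

text \<open>
  The window is the one that \<open>window_from_factor\<close> forces.  It is irredundant because a period \<open>h\<close>
  makes the window look the same from \<open>h\<close> as from \<open>0\<close>: a point of the fibre over \<open>h\<close> is then equal
  to \<open>x\<close>, whose image is \<open>0\<close>.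
\<close>
lemma almost_automorphic_window:
  fixes \<tau> :: "'g::group_add \<Rightarrow> 'h::topological_group_add"
  assumes "metrizable_compactification \<tau>" "almost_automorphic \<tau> x"
  shows "\<exists>W \<in> windows \<tau>. window_point \<tau> W = x"
proof -
  note hom = metrizable_compactification_simps[OF assms(1)]
  have metr: "metrizable_space (euclidean :: 'h topology)"
    using assms(1) by (simp add: metrizable_compactification_def)
  obtain \<beta> where \<beta>: "orbit_closure_factor \<tau> x \<beta>" and fib: "orbit_closure_fibre x \<beta> 0 = {x}"
    using assms(2) by (auto simp: almost_automorphic_def)
  have x0: "\<beta> x = 0"
    using fib by (auto simp: orbit_closure_fibre_def)
  define X where "X = closure (shift_orbit x)"
  define S where "S = X \<inter> {y. y 0 = True}"
  define W where "W = \<beta> ` S"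
  define V where "V = {\<xi>. \<forall>y \<in> orbit_closure_fibre x \<beta> \<xi>. y 0}"
  have W_closed: "closed W"
    unfolding W_def S_def X_def
    by (rule closed_factor_image[OF metr orbit_closure_factorD(1)[OF \<beta>]])
      (intro closed_Int closed_closure closed_coordinate Int_lower1)+
  have W_alt: "W = {\<xi>. \<exists>y \<in> orbit_closure_fibre x \<beta> \<xi>. y 0}"
    by (auto simp: W_def S_def X_def orbit_closure_fibre_def)
  have V_W: "V \<subseteq> interior W"
    using all_fibre_subset_ex_fibre[OF \<beta>] open_all_fibre[OF assms(1) \<beta>]
    by (intro interior_maximal) (auto simp: V_def W_alt)
  have trace_W: "\<tau> g \<in> W \<longleftrightarrow> x g" and trace_V: "\<tau> g \<in> V \<longleftrightarrow> x g" for g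
    using fibre_over_orbit[OF assms(1) \<beta> fib, of g]
    by (auto simp: W_alt V_def shift_action_def)
  have x_eq: "x = window_point \<tau> W"
    by (simp add: window_point_def trace_W)
  have generic: "generic_window \<tau> W"
    using trace_W trace_V V_W W_closed by (auto simp: generic_window_def frontier_def closure_closed)
  have "W \<subseteq> closure (interior W)"
  proof -
    let ?O = "{y. y 0 = True} \<inter> shift_orbit x"
    \<comment> \<open>Since \<open>{y. y 0}\<close> is open, the orbit points in it already approximate all of \<open>S\<close>.\<close>
    have "S \<subseteq> closure ?O"
      using open_Int_closure_subset[OF open_coordinate[of 0 True], of "shift_orbit x"]
      by (auto simp: S_def X_def)
    moreover have "\<beta> ` closure ?O \<subseteq> closure (interior W)"
    proof (rule image_closure_subset)
      show "continuous_on (closure ?O) \<beta>"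
        using orbit_closure_factorD(1)[OF \<beta>] closure_mono[of ?O "shift_orbit x"]
        by (auto intro: continuous_on_subset)
      have "\<beta> y \<in> interior W" if "y \<in> ?O" for y
      proof -
        obtain g where "y = shift_action g x" "x g"
          using \<open>y \<in> ?O\<close> by (auto simp: shift_orbit_def shift_action_def)
        then show ?thesis
          using factor_on_orbit[OF \<beta> x0] trace_V V_W by auto
      qed
      then show "\<beta> ` ?O \<subseteq> closure (interior W)"
        using closure_subset[of "interior W"] by blast
    qed simp
    ultimately show ?thesis
      by (auto simp: W_def)
  qed
  then have proper: "proper_window W"
    using closure_mono[OF interior_subset, of W] W_closed
    by (simp add: proper_window_def closure_closed subset_antisym)
  have "h = 0" if h: "(\<lambda>w. w + h) ` W = W" for h
  proof -
    obtain z where z: "z \<in> X" "\<beta> z = h"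
      using orbit_closure_factorD(2)[OF \<beta>] unfolding X_def by (metis UNIV_I imageE)
    then have compat: "window_compatible \<tau> W z h"
      using factor_compatible[OF hom(1) W_closed x_eq \<beta> x0] by (auto simp: X_def)
    have backward: "w \<in> W" if "w + h \<in> W" for w
      using that h by (metis (no_types, lifting) add_right_cancel imageE)
    have "open ((\<lambda>w. w + - h) -` interior W)"
      by (rule open_vimage[OF open_interior continuous_on_right_translation])
    moreover have "(\<lambda>w. w + - h) -` interior W \<subseteq> W"
    proof
      fix w assume "w \<in> (\<lambda>w. w + - h) -` interior W"
      then have "w + - h \<in> W"
        using interior_subset by auto
      then have "w + - h + h \<in> W"
        using h by blast
      then show "w \<in> W"
        by (simp add: add.assoc)
    qed
    ultimately have "(\<lambda>w. w + - h) -` interior W \<subseteq> interior W"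
      by (rule interior_maximal[rotated])
    then have forward: "w + h \<in> interior W" if "w \<in> interior W" for w
      using that by (auto simp: add.assoc)
    have "z = x"
    proof
      fix g
      show "z g = x g"
        using compat backward[of "\<tau> g"] forward[of "\<tau> g"] trace_W[of g] trace_V[of g] V_W
        unfolding window_compatible_def by blast
    qed
    then show ?thesis
      using z(2) x0 by simp
  qed
  then have "irredundant_window W"
    by (simp add: irredundant_window_def)
  then have "W \<in> windows \<tau>"
    using proper generic by (simp add: windows_def)
  then show ?thesis
    using x_eq by blast
qed

theorem theorem1p1:
  fixes \<tau> :: "'g::{group_add, countable} \<Rightarrow> 'h::topological_group_add"
  assumes "metrizable_compactification \<tau>"
  shows "bij_betw (window_point \<tau>) (windows \<tau>) {x. almost_automorphic \<tau> x} \<and>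
    (\<forall>W x \<beta>. W \<in> windows \<tau> \<and> x = window_point \<tau> W \<and>
        orbit_closure_factor \<tau> x \<beta> \<and> orbit_closure_fibre x \<beta> 0 = {x} \<longrightarrow>
      W = {\<xi>. \<exists>y \<in> orbit_closure_fibre x \<beta> \<xi>. y 0} \<and>
      frontier W = W - {\<xi>. \<forall>y \<in> orbit_closure_fibre x \<beta> \<xi>. y 0})"
proof (intro conjI allI impI)
  have "window_point \<tau> ` windows \<tau> = {x. almost_automorphic \<tau> x}"
    using window_point_almost_automorphic[OF assms] almost_automorphic_window[OF assms] by blast
  then show "bij_betw (window_point \<tau>) (windows \<tau>) {x. almost_automorphic \<tau> x}"
    using window_point_inj[OF metrizable_compactification_simps(3)[OF assms]]
    by (simp add: bij_betw_def)
next
  fix W x \<beta>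
  assume *: "W \<in> windows \<tau> \<and> x = window_point \<tau> W \<and>
        orbit_closure_factor \<tau> x \<beta> \<and> orbit_closure_fibre x \<beta> 0 = {x}"
  then have W: "proper_window W" and x: "x = window_point \<tau> W"
    and \<beta>: "orbit_closure_factor \<tau> x \<beta>" and x0: "\<beta> x = 0"
    by (auto simp: windows_def orbit_closure_fibre_def)
  show "W = {\<xi>. \<exists>y \<in> orbit_closure_fibre x \<beta> \<xi>. y 0}"
    by (rule window_from_factor[OF assms W x \<beta> x0])
  show "frontier W = W - {\<xi>. \<forall>y \<in> orbit_closure_fibre x \<beta> \<xi>. y 0}"
    using interior_window_from_factor[OF assms W x \<beta> x0] proper_window_closed[OF W]
    by (simp add: frontier_def closure_closed)
qed

end
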